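(* Let $S$ be a countable discrete set, $X=S^{\mathbb Z}$, $X^+=S^{\mathbb Z_+}$, and let $g$ be a $g$-function (on $X^+$) such that $g>0$ everywhere and $$\sum_{n=1}^{\infty}\left(\operatorname{svar}_n\sqrt g\right)^2<\infty .$$ Then there is at most one $g$-measure on $X$.
   Context: $S$ is a countable set with the discrete topology; $\mathbb Z_+=\{0,1,2,\dots\}$. $X=S^{\mathbb Z}$ and $X^+=S^{\mathbb Z_+}$ carry the product topology and Borel $\sigma$-algebra. $T$ is the left shift on $X$, $(Tx)_i=x_{i+1}$ for $i\in\mathbb Z$. For $\sigma\in S$ and $y\in X^+$, $(\sigma,y)=(\sigma,y_0,y_1,\dots)\in X^+$. A $g$-function is a (nonnegative) Borel measurable function $g:X^+\to[0,1]$ with $\sum_{\sigma\in S}g(\sigma,y)=1$ for every $y\in X^+$; it is regarded as a function on $X$ via $g(x)=g(x_0,x_1,\dots)$. A $g$-measure is a $T$-invariant Borel probability measure $\mu$ on $X$ such that $g$ is the conditional probability of the coordinate $x_0$ given $x_1,x_2,\dots$, i.e. for every $\sigma\in S$, $\mu(x_0=\sigma\mid x_1,x_2,\dots)=g(\sigma,x_1,x_2,\dots)$ $\mu$-a.e.; equivalently $g(x)=\lim_n \mu[x_0,\dots,x_n]/\mu[x_1,\dots,x_n]$ for $\mu$-a.e. $x$. For $f:X^+\to\mathbb R$, $x\in X^+$ and $n\ge0$: $\operatorname{var}_n f(x)=\sup\{|f(x)-f(y)| : y\in X^+,\ y_i=x_i \text{ for } i\le n\}$, and $$\operatorname{svar}_n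 f=\sup_{x\in X^+}\Big(\sum_{\sigma\in S}\big(\operatorname{var}_{n+1}f(\sigma,x)\big)^2\Big)^{1/2}.$$ *)

theory Defs
  imports "HOL-Probability.Probability"
begin

text \<open>
  The alphabet \<open>S\<close> is a type \<open>'s\<close> of sort \<open>{countable, discrete_topology}\<close> (finite or countably
  infinite), \<open>X\<^sup>+\<close> is \<open>nat \<Rightarrow> 's\<close> and \<open>X\<close> is \<open>int \<Rightarrow> 's\<close>. The topology on these function types is
  the product topology of \<^theory>\<open>HOL-Analysis.Function_Topology\<close> and \<open>borel\<close> is its Borel
  sigma-algebra. The concatenation \<open>(\<sigma>, y)\<close> is \<open>case_nat \<sigma> y\<close>.
\<close>

definition shift :: "(int \<Rightarrow> 's) \<Rightarrow> (int \<Rightarrow> 's)" where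
  "shift x = (\<lambda>i. x (i + 1))"

text \<open>\<open>future x\<close> is the sequence \<open>(x\<^sub>1, x\<^sub>2, \<dots>)\<close>, re-indexed to start at \<open>0\<close>.\<close>

definition future :: "(int \<Rightarrow> 's) \<Rightarrow> (nat \<Rightarrow> 's)" where
  "future x = (\<lambda>i. x (int i + 1))"

definition g_function :: "((nat \<Rightarrow> 's::{countable, discrete_topology}) \<Rightarrow> real) \<Rightarrow> bool" where
  "g_function g \<longleftrightarrow>
     g \<in> borel_measurable borel \<and>
     (\<forall>x. 0 \<le> g x \<and> g x \<le> 1) \<and>
     (\<forall>y. ((\<lambda>\<sigma>. g (case_nat \<sigma> y)) has_sum 1) UNIV)"

text \<open>
  The sigma-algebra generated by \<open>x\<^sub>1, x\<^sub>2, \<dots>\<close> is the pull-back of the Borel sigma-algebra of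
  \<open>X\<^sup>+\<close> along \<open>future\<close>.
\<close>

definition g_measure ::
  "((nat \<Rightarrow> 's::{countable, discrete_topology}) \<Rightarrow> real) \<Rightarrow> (int \<Rightarrow> 's) measure \<Rightarrow> bool" where
  "g_measure g \<mu> \<longleftrightarrow>
     sets \<mu> = sets borel \<and>
     prob_space \<mu> \<and>
     distr \<mu> borel shift = \<mu> \<and>
     (\<forall>\<sigma>. AE x in \<mu>.
        real_cond_exp \<mu> (vimage_algebra UNIV future borel) (indicator {x. x 0 = \<sigma>}) x
          = g (case_nat \<sigma> (future x)))"

text \<open>
  For infinite \<open>S\<close> the sum below may diverge, so the variations take values in \<open>[0, \<infinity>]\<close>.
\<close>

definition var :: "nat \<Rightarrow> ((nat \<Rightarrow> 's) \<Rightarrow> real) \<Rightarrow> (nat \<Rightarrow> 's) \<Rightarrow> ennreal" where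
  "var n f x = (SUP y\<in>{y. \<forall>i\<le>n. y i = x i}. ennreal \<bar>f x - f y\<bar>)"

definition ennsqrt :: "ennreal \<Rightarrow> ennreal" where
  "ennsqrt a = (if a = \<infinity> then \<infinity> else ennreal (sqrt (enn2real a)))"

definition svar :: "nat \<Rightarrow> ((nat \<Rightarrow> 's) \<Rightarrow> real) \<Rightarrow> ennreal" where
  "svar n f = (SUP x. ennsqrt (\<Sum>\<^sub>\<infinity>\<sigma>\<in>UNIV. (var (n + 1) f (case_nat \<sigma> x))\<^sup>2))"

end

theory Submission
  imports Defs
begin

text \<open>
  Restrict a \<open>g\<close>-measure to the coordinates \<open>x\<^sub>1, x\<^sub>2, \<dots>\<close>. Because
  \<open>g\<close> is the conditional probability of \<open>x\<^sub>0\<close> given these, the one-sided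
  marginal is stationary for the Markov chain on one-sided sequences that prepends to \<open>y\<close> the
  symbol \<open>\<sigma>\<close> with probability \<open>g (\<sigma>, y)\<close>; the transition kernel of
  this chain acts on functions as the operator \<open>transfer g\<close> (lemma
  \<open>g_measure_stationary\<close>). Shift invariance recovers the two-sided measure from this marginal
  (lemma \<open>shift_invariant_eq_if_future_eq\<close>), so it suffices that the chain has only one
  stationary probability measure.

  Run the chain for \<open>N\<close> steps from two sequences \<open>y\<close>, \<open>y'\<close> that agree
  in the coordinates up to \<open>n\<close>, and compare the probabilities that the two runs prepend the same
  word. Once they have prepended the same \<open>k\<close> symbols they agree up to coordinate \<open>n +
  k\<close>, so the squared Hellinger distance of the laws of the next symbol is at most the square of
  \<open>svar (n + k) (sqrt g)\<close>. Hellinger affinities multiply along the run, hence the affinity of the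
  two laws of the prepended word is at least \<open>1\<close> minus the sum of these squares. For large
  \<open>n\<close> the sum is a small tail of a convergent series, uniformly in \<open>N\<close>: the two laws
  cannot be almost disjoint, for any length \<open>N\<close> (lemma \<open>pasts_not_separated\<close>). This
  is where square summability enters.

  Let a stationary measure charge both a shift-invariant set \<open>A\<close> and its complement. Its
  restrictions to \<open>A\<close> and to \<open>- A\<close> are again stationary, and since \<open>g >
  0\<close> each charges every cylinder, in particular the set \<open>W\<close> of sequences with a prescribed
  beginning of length \<open>n + 1\<close>. Approximate \<open>A\<close> by a set \<open>C\<close> that
  depends on the first \<open>N\<close> coordinates only. By stationarity, \<open>N\<close> steps from most
  \<open>y\<close> in \<open>W \<inter> A\<close> lead into \<open>C\<close> with probability close to one,
  and from most \<open>y'\<close> in \<open>W - A\<close> into \<open>- C\<close> with probability close to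
  one, which contradicts the previous paragraph. So every stationary measure is ergodic (lemma
  \<open>stationary_ergodic\<close>). Finally, the density of one stationary probability measure with respect
  to its average with another is shift-invariant, hence trivial, and the two coincide (lemma
  \<open>stationary_unique\<close>).
\<close>

section \<open>Sets determined by finitely many coordinates\<close>

definition determined_by :: "'i set \<Rightarrow> ('i \<Rightarrow> 's) set \<Rightarrow> bool" where
  "determined_by J C \<longleftrightarrow> (\<forall>x y. (\<forall>i\<in>J. x i = y i) \<longrightarrow> (x \<in> C \<longleftrightarrow> y \<in> C))"

lemma determined_by_mono: "determined_by J C \<Longrightarrow> J \<subseteq> K \<Longrightarrow> determined_by K C"
  unfolding determined_by_def by (meson subsetD)

lemma determined_by_Compl: "determined_by J C \<Longrightarrow> determined_by J (- C)"
  unfolding determined_by_def by simp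

lemma determined_by_Int:
  "determined_by J C \<Longrightarrow> determined_by K D \<Longrightarrow> determined_by (J \<union> K) (C \<inter> D)"
  unfolding determined_by_def by (metis UnCI Int_iff)

lemma open_coordinate_fixed:
  fixes s :: "'s::discrete_topology"
  shows "open {x :: 'i \<Rightarrow> 's. x i = s}"
proof -
  have "open ((\<lambda>x :: 'i \<Rightarrow> 's. x i) -` {s})"
    by (rule open_vimage[OF discrete_topology_class.open_discrete continuous_on_product_coordinates])
  then show ?thesis by (simp add: vimage_def)
qed

lemma open_determined_by:
  fixes C :: "('i \<Rightarrow> 's::discrete_topology) set"
  assumes "finite J" "determined_by J C"
  shows "open C"
proof -
  have "C = (\<Union>x\<in>C. \<Inter>i\<in>J. {y. y i = x i})"
  proof (intro subset_antisym subsetI)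
    fix y assume "y \<in> (\<Union>x\<in>C. \<Inter>i\<in>J. {y. y i = x i})"
    then obtain x where "x \<in> C" "\<forall>i\<in>J. y i = x i" by auto
    then show "y \<in> C" using assms(2) unfolding determined_by_def by blast
  qed auto
  moreover have "open (\<Union>x\<in>C. \<Inter>i\<in>J. {y. y i = x i})"
    using assms(1) by (intro open_UN ballI open_INT open_coordinate_fixed)
  ultimately show ?thesis by simp
qed

lemma open_determined_locally:
  fixes U :: "('i \<Rightarrow> 's::topological_space) set"
  assumes "open U" "x \<in> U"
  shows "\<exists>J. finite J \<and> (\<forall>y. (\<forall>i\<in>J. y i = x i) \<longrightarrow> y \<in> U)"
proof -
  have "openin (product_topology (\<lambda>i. euclidean) UNIV) U"
    using assms(1) unfolding open_fun_def by simp
  from product_topology_open_contains_basis[OF this assms(2)] obtain X where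
    X: "x \<in> (\<Pi>\<^sub>E i\<in>UNIV. X i)" "finite {i. X i \<noteq> topspace (euclidean :: 's topology)}"
      "(\<Pi>\<^sub>E i\<in>UNIV. X i) \<subseteq> U" by blast
  have "y \<in> U" if "\<forall>i\<in>{i. X i \<noteq> UNIV}. y i = x i" for y
  proof -
    have "y i \<in> X i" for i
      using that X(1) by (cases "X i = UNIV") (auto simp: PiE_iff)
    then show ?thesis using X(3) by (auto simp: PiE_iff)
  qed
  then show ?thesis using X(2) by (intro exI[of _ "{i. X i \<noteq> UNIV}"]) simp
qed

text \<open>
  An open set \<open>U\<close> is the increasing union, over \<open>n\<close>, of the sets of points whose
  first \<open>n\<close> coordinates, in an enumeration of the index set, already force membership in
  \<open>U\<close>. Countability of the index set is what makes this a countable union.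
\<close>

lemma sets_borel_determined_by:
  "sets (borel :: ('i::countable \<Rightarrow> 's::discrete_topology) measure)
     = sigma_sets UNIV {C. \<exists>J. finite J \<and> determined_by J C}"
    (is "_ = sigma_sets UNIV ?G")
proof
  show "sigma_sets UNIV ?G \<subseteq> sets borel"
  proof -
    have "?G \<subseteq> sets borel" by (auto intro!: borel_open open_determined_by)
    from sets.sigma_sets_subset[OF this] show ?thesis by simp
  qed
  have "U \<in> sigma_sets UNIV ?G" if "open U" for U :: "('i \<Rightarrow> 's) set"
  proof -
    define J where "J n = {i :: 'i. to_nat i < n}" for n
    define V where "V n = {x. \<forall>y. (\<forall>i\<in>J n. y i = x i) \<longrightarrow> y \<in> U}" for n
    have fin: "finite (J n)" for n
      unfolding J_def by (rule finite_imageD[of to_nat]) (auto intro: finite_subset[of _ "{..<n}"])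
    have "determined_by (J n) (V n)" for n
      unfolding determined_by_def V_def by auto
    then have "V n \<in> sigma_sets UNIV ?G" for n
      using fin by auto
    moreover have "U = (\<Union>n. V n)"
    proof
      show "U \<subseteq> (\<Union>n. V n)"
      proof
        fix x assume "x \<in> U"
        then obtain K where K: "finite K" "\<forall>y. (\<forall>i\<in>K. y i = x i) \<longrightarrow> y \<in> U"
          using open_determined_locally[OF \<open>open U\<close>] by blast
        obtain n where "\<forall>k\<in>to_nat ` K. k < n"
          using finite_nat_set_iff_bounded K(1) by blast
        then have "K \<subseteq> J n" by (auto simp: J_def)
        then have "x \<in> V n" using K(2) unfolding V_def by blast
        then show "x \<in> (\<Union>n. V n)" by blast
      qed
      show "(\<Union>n. V n) \<subseteq> U" unfolding V_def by auto
    qed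
    ultimately show ?thesis by (metis sigma_sets.Union)
  qed
  then have "sigma_sets UNIV {U :: ('i \<Rightarrow> 's) set. open U} \<subseteq> sigma_sets UNIV ?G"
    by (intro sigma_sets_mono) auto
  then show "sets borel \<subseteq> sigma_sets UNIV ?G"
    by (simp add: borel_def)
qed

text \<open>
  The sets determined by finitely many coordinates form an algebra that generates the Borel sets, and the sets
  with arbitrarily good approximations from an algebra form a \<open>\<sigma>\<close>-algebra.
\<close>

lemma approximation_by_determined:
  fixes M :: "('i::countable \<Rightarrow> 's::discrete_topology) measure"
  assumes M: "finite_measure M" "sets M = sets borel"
    and "A \<in> sets borel" "e > 0"
  shows "\<exists>J C. finite J \<and> determined_by J C \<and> measure M ((A - C) \<union> (C - A)) < e"
proof -
  interpret finite_measure M by fact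
  have sp: "space M = UNIV" using sets_eq_imp_space_eq[OF M(2)] by simp
  have open_sets: "C \<in> sets M" if "finite J" "determined_by J C" for J C
    using open_determined_by[OF that] M(2) by auto
  have "A \<in> sigma_sets UNIV {C. \<exists>J. finite J \<and> determined_by J C}"
    using assms(3) by (simp add: sets_borel_determined_by)
  then show ?thesis using \<open>e > 0\<close>
  proof (induction arbitrary: e)
    case (Basic A)
    then show ?case by force
  next
    case Empty
    have "determined_by {} {}" by (simp add: determined_by_def)
    then show ?case using Empty by (intro exI[of _ "{}"]) simp
  next
    case (Compl A)
    then obtain J C where "finite J" "determined_by J C" "measure M ((A - C) \<union> (C - A)) < e"
      by blast
    moreover have "((UNIV - A) - (- C)) \<union> ((- C) - (UNIV - A)) = (A - C) \<union> (C - A)" by auto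
    ultimately show ?case using determined_by_Compl by metis
  next
    case (Union A)
    have A: "A i \<in> sets M" for i
      using Union.hyps[of i] M(2) by (simp add: sets_borel_determined_by)
    have "(\<lambda>n. measure M (\<Union>i<n. A i)) \<longlonglongrightarrow> measure M (\<Union>n. \<Union>i<n. A i)"
      using A by (intro finite_Lim_measure_incseq) (fastforce simp: incseq_def)+
    moreover have "(\<Union>n. \<Union>i<n. A i) = (\<Union>i. A i)" by auto
    ultimately have "(\<lambda>n. measure M (\<Union>i<n. A i)) \<longlonglongrightarrow> measure M (\<Union>i. A i)" by simp
    from LIMSEQ_D[OF this, of "e / 2"] Union.prems obtain n where
      n: "norm (measure M (\<Union>i<n. A i) - measure M (\<Union>i. A i)) < e / 2" by auto
    define B where "B = (\<Union>i<n. A i)"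
    have B: "B \<in> sets M" "(\<Union>i. A i) \<in> sets M" using A by (auto simp: B_def)
    have diff: "measure M ((\<Union>i. A i) - B) < e / 2"
    proof -
      have "B \<subseteq> (\<Union>i. A i)" by (auto simp: B_def)
      then have "measure M ((\<Union>i. A i) - B) = measure M (\<Union>i. A i) - measure M B"
        using finite_measure_Diff B by blast
      then show ?thesis using n unfolding B_def real_norm_def by linarith
    qed
    \<comment> \<open>The summand one in the denominator covers \<open>n = 0\<close>.\<close>
    define d where "d = e / 2 / (real n + 1)"
    have "d > 0" using Union.prems by (simp add: d_def)
    then have "\<forall>i. \<exists>J C. finite J \<and> determined_by J C \<and> measure M ((A i - C) \<union> (C - A i)) < d"
      using Union.IH by blast
    then obtain J C where JC: "\<And>i. finite (J i)" "\<And>i. determined_by (J i) (C i)"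
      "\<And>i. measure M ((A i - C i) \<union> (C i - A i)) < d" by metis
    define D where "D = (\<Union>i<n. C i)"
    have D: "determined_by (\<Union>i<n. J i) D"
      unfolding D_def determined_by_def using JC(2) unfolding determined_by_def
      by (auto, meson lessThan_iff, meson lessThan_iff)
    have C: "C i \<in> sets M" for i using open_sets JC by blast
    have "measure M (\<Union>i<n. ((A i - C i) \<union> (C i - A i)))
        \<le> (\<Sum>i<n. measure M ((A i - C i) \<union> (C i - A i)))"
      using A C by (intro finite_measure_subadditive_finite) auto
    also have "\<dots> \<le> (\<Sum>i<n. d)" by (intro sum_mono less_imp_le JC)
    also have "\<dots> \<le> e / 2" using Union.prems by (simp add: d_def field_simps)
    finally have small: "measure M (\<Union>i<n. ((A i - C i) \<union> (C i - A i))) \<le> e / 2" .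
    have "measure M (((\<Union>i. A i) - D) \<union> (D - (\<Union>i. A i)))
       \<le> measure M (((\<Union>i. A i) - B) \<union> (\<Union>i<n. ((A i - C i) \<union> (C i - A i))))"
      using A B C by (intro finite_measure_mono) (auto simp: B_def D_def)
    also have "\<dots> \<le> measure M ((\<Union>i. A i) - B) + measure M (\<Union>i<n. ((A i - C i) \<union> (C i - A i)))"
      using A B C by (intro measure_Un_le) auto
    also have "\<dots> < e" using diff small by simp
    finally show ?case using D JC(1) by (intro exI[of _ "\<Union>i<n. J i"] exI[of _ D]) auto
  qed
qed

section \<open>The transfer operator\<close>

text \<open>
  The expectation of \<open>f\<close> after prepending to \<open>y\<close> a random symbol with law
  \<open>\<sigma> \<mapsto> g (\<sigma>, y)\<close>: the Ruelle transfer operator with normalised weight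
  \<open>g\<close>.
\<close>

definition transfer :: "((nat \<Rightarrow> 's) \<Rightarrow> real) \<Rightarrow> ((nat \<Rightarrow> 's) \<Rightarrow> ennreal) \<Rightarrow> (nat \<Rightarrow> 's) \<Rightarrow> ennreal" where
  "transfer g f y = (\<integral>\<^sup>+\<sigma>. ennreal (g (case_nat \<sigma> y)) * f (case_nat \<sigma> y) \<partial>count_space UNIV)"

text \<open>
  The definitions of \<open>svar\<close> and of \<open>g_function\<close> use unordered sums; integrals with
  respect to counting measure give access to monotone convergence, Fubini and Cauchy-Schwarz.
\<close>

lemma nn_integral_count_space_eq_infsum:
  fixes f :: "'s::countable \<Rightarrow> ennreal"
  shows "(\<integral>\<^sup>+\<sigma>. f \<sigma> \<partial>count_space UNIV) = infsum f UNIV"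
proof -
  have sup: "infsum f UNIV = (SUP F\<in>{F. finite F}. sum f F)"
    using nonneg_infsum_complete[of UNIV f] by simp
  define E where "E n = {s :: 's. to_nat s < n}" for n
  have fin: "finite (E n)" for n
    unfolding E_def by (rule finite_imageD[of to_nat]) (auto intro: finite_subset[of _ "{..<n}"])
  have restr: "(\<integral>\<^sup>+\<sigma>. f \<sigma> * indicator F \<sigma> \<partial>count_space UNIV) = sum f F" if "finite F" for F
    using that by (subst nn_integral_count_space'[where A = F]) (auto intro: sum.cong)
  have "f \<sigma> = (SUP n. f \<sigma> * indicator (E n) \<sigma>)" for \<sigma>
  proof (rule antisym)
    show "f \<sigma> \<le> (SUP n. f \<sigma> * indicator (E n) \<sigma>)"
      by (rule SUP_upper2[of "Suc (to_nat \<sigma>)"]) (auto simp: E_def)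
    show "(SUP n. f \<sigma> * indicator (E n) \<sigma>) \<le> f \<sigma>"
      by (intro SUP_least) (auto split: split_indicator)
  qed
  then have "(\<integral>\<^sup>+\<sigma>. f \<sigma> \<partial>count_space UNIV)
      = (\<integral>\<^sup>+\<sigma>. (SUP n. f \<sigma> * indicator (E n) \<sigma>) \<partial>count_space UNIV)" by simp
  also have "\<dots> = (SUP n. \<integral>\<^sup>+\<sigma>. f \<sigma> * indicator (E n) \<sigma> \<partial>count_space UNIV)"
    by (intro nn_integral_monotone_convergence_SUP)
       (auto simp: incseq_def le_fun_def E_def split: split_indicator)
  also have "\<dots> \<le> infsum f UNIV"
    unfolding sup using fin by (intro SUP_least) (simp add: restr SUP_upper)
  finally have "(\<integral>\<^sup>+\<sigma>. f \<sigma> \<partial>count_space UNIV) \<le> infsum f UNIV" .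
  moreover have "infsum f UNIV \<le> (\<integral>\<^sup>+\<sigma>. f \<sigma> \<partial>count_space UNIV)"
    unfolding sup
  proof (intro SUP_least)
    fix F :: "'s set" assume "F \<in> {F. finite F}"
    then have "sum f F = (\<integral>\<^sup>+\<sigma>. f \<sigma> * indicator F \<sigma> \<partial>count_space UNIV)" by (simp add: restr)
    also have "\<dots> \<le> (\<integral>\<^sup>+\<sigma>. f \<sigma> \<partial>count_space UNIV)"
      by (intro nn_integral_mono) (auto split: split_indicator)
    finally show "sum f F \<le> (\<integral>\<^sup>+\<sigma>. f \<sigma> \<partial>count_space UNIV)" .
  qed
  ultimately show ?thesis by simp
qed

lemma g_function_sum:
  assumes "g_function g"
  shows "(\<integral>\<^sup>+\<sigma>. ennreal (g (case_nat \<sigma> y)) \<partial>count_space UNIV) = 1"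
proof -
  have hs: "((\<lambda>\<sigma>. g (case_nat \<sigma> y)) has_sum 1) UNIV" and nn: "\<And>x. 0 \<le> g x"
    using assms by (auto simp: g_function_def)
  have "infsum (\<lambda>\<sigma>. ennreal (g (case_nat \<sigma> y))) UNIV
      = (SUP F\<in>{F. finite F}. (\<Sum>\<sigma>\<in>F. ennreal (g (case_nat \<sigma> y))))"
    using nonneg_infsum_complete[of UNIV "\<lambda>\<sigma>. ennreal (g (case_nat \<sigma> y))"] by simp
  also have "\<dots> = ennreal (infsum (\<lambda>\<sigma>. g (case_nat \<sigma> y)) UNIV)"
    using infsum_nonneg_is_SUPREMUM_ennreal[of "\<lambda>\<sigma>. g (case_nat \<sigma> y)" UNIV] hs nn
    by (simp add: has_sum_imp_summable sum_ennreal)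
  also have "\<dots> = 1" using infsumI[OF hs] by simp
  finally show ?thesis by (simp add: nn_integral_count_space_eq_infsum)
qed

lemma transfer_one: "g_function g \<Longrightarrow> transfer g (\<lambda>_. 1) y = 1"
  using g_function_sum[of g y] by (simp add: transfer_def)

lemma transfer_mono: "(\<And>x. f x \<le> h x) \<Longrightarrow> transfer g f y \<le> transfer g h y"
  unfolding transfer_def by (intro nn_integral_mono mult_left_mono) auto

lemma transfer_iter_le_one:
  assumes "g_function g" "\<And>x. f x \<le> 1"
  shows "(transfer g ^^ N) f y \<le> 1"
proof (induction N arbitrary: y)
  case (Suc N)
  have "transfer g ((transfer g ^^ N) f) y \<le> transfer g (\<lambda>_. 1) y"
    using Suc by (rule transfer_mono)
  then show ?case using transfer_one[OF assms(1)] by simp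
qed (use assms in simp)

lemma measurable_case_nat_cons [measurable]:
  "(\<lambda>y. case_nat \<sigma> y) \<in> (borel :: (nat \<Rightarrow> 's::topological_space) measure) \<rightarrow>\<^sub>M borel"
proof (intro borel_measurable_continuous_onI continuous_on_coordinatewise_then_product)
  show "continuous_on UNIV (\<lambda>y :: nat \<Rightarrow> 's. case_nat \<sigma> y i)" for i
    by (cases i) auto
qed

lemma borel_measurable_transfer [measurable]:
  fixes g :: "(nat \<Rightarrow> 's::{countable, discrete_topology}) \<Rightarrow> real"
  assumes [measurable]: "g \<in> borel_measurable borel" "f \<in> borel_measurable borel"
  shows "transfer g f \<in> borel_measurable borel"
proof -
  interpret sigma_finite_measure "count_space (UNIV :: 's set)"
    by (rule sigma_finite_measure_count_space_countable) simp
  have "(\<lambda>(\<sigma>, y). ennreal (g (case_nat \<sigma> y)) * f (case_nat \<sigma> y))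
      \<in> borel_measurable (count_space UNIV \<Otimes>\<^sub>M borel)"
    by (rule measurable_pair_measure_countable1) auto
  then have "(\<lambda>(y, \<sigma>). ennreal (g (case_nat \<sigma> y)) * f (case_nat \<sigma> y))
      \<in> borel_measurable (borel \<Otimes>\<^sub>M count_space UNIV)"
    by (subst measurable_pair_swap_iff) (simp add: case_prod_unfold)
  then show ?thesis
    unfolding transfer_def by (rule borel_measurable_nn_integral)
qed

lemma borel_measurable_transfer_iter:
  fixes g :: "(nat \<Rightarrow> 's::{countable, discrete_topology}) \<Rightarrow> real"
  assumes "g \<in> borel_measurable borel" "f \<in> borel_measurable borel"
  shows "(transfer g ^^ N) f \<in> borel_measurable borel"
  by (induction N) (use assms borel_measurable_transfer in auto)

text \<open>
  Dropping the symbol that was just prepended gives back the old state, so a factor that depends only on the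
  tail comes out of the transfer operator.
\<close>

lemma transfer_tail:
  "transfer g (\<lambda>x. u (x \<circ> Suc) * f x) y = u y * transfer g f y"
proof -
  have "case_nat \<sigma> y \<circ> Suc = y" for \<sigma> by auto
  then have "transfer g (\<lambda>x. u (x \<circ> Suc) * f x) y
      = (\<integral>\<^sup>+\<sigma>. u y * (ennreal (g (case_nat \<sigma> y)) * f (case_nat \<sigma> y)) \<partial>count_space UNIV)"
    by (simp add: transfer_def mult_ac)
  then show ?thesis by (simp add: nn_integral_cmult transfer_def)
qed

text \<open>
  From any starting point the chain can prepend the symbol \<open>c\<close> for \<open>N\<close> steps in a
  row: this has positive probability since \<open>g > 0\<close>.
\<close>

lemma transfer_iter_pos:
  fixes g :: "(nat \<Rightarrow> 's) \<Rightarrow> real"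
  assumes "\<And>x. g x > 0" and "\<And>x. (\<forall>i<N. x i = c) \<Longrightarrow> f x > 0"
  shows "(transfer g ^^ N) f y > 0"
  using assms(2)
proof (induction N arbitrary: f)
  case (Suc N)
  have pos: "transfer g f x > 0" if "\<forall>i<N. x i = c" for x
  proof -
    have "\<forall>i<Suc N. (case_nat c x :: nat \<Rightarrow> 's) i = c"
      using that by (auto split: nat.split)
    then have "0 < ennreal (g (case_nat c x)) * f (case_nat c x)"
      using Suc.prems assms(1) by (simp add: ennreal_zero_less_mult_iff)
    also have "\<dots> \<le> (\<integral>\<^sup>+\<sigma>. ennreal (g (case_nat \<sigma> x)) * f (case_nat \<sigma> x) \<partial>count_space UNIV)"
      by (rule nn_integral_ge_point) simp
    finally show ?thesis by (simp add: transfer_def)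
  qed
  show ?case
    using Suc.IH[of "transfer g f"] pos by (simp add: funpow_swap1)
qed simp

section \<open>Hellinger affinity of two runs of the chain\<close>

lemma ennsqrt_power2 [simp]: "(ennsqrt a)\<^sup>2 = a"
proof (cases a)
  case (real r)
  then show ?thesis by (simp add: ennsqrt_def ennreal_power)
next
  case top
  then show ?thesis by (simp add: ennsqrt_def power2_eq_square)
qed

lemma ennreal_power2_le_iff:
  fixes a b :: ennreal shows "a\<^sup>2 \<le> b\<^sup>2 \<longleftrightarrow> a \<le> b"
proof
  assume le: "a\<^sup>2 \<le> b\<^sup>2"
  show "a \<le> b"
  proof (cases b)
    case (real s)
    then have b: "b\<^sup>2 = ennreal (s\<^sup>2)" by (simp add: ennreal_power)
    show ?thesis
    proof (cases a)
      case (real r)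
      then have "ennreal (r\<^sup>2) \<le> ennreal (s\<^sup>2)" using le b by (simp add: ennreal_power)
      then have "r\<^sup>2 \<le> s\<^sup>2" by (subst (asm) ennreal_le_iff) auto
      then have "r \<le> s" using \<open>0 \<le> s\<close> by (rule power2_le_imp_le)
      then show ?thesis using real \<open>b = ennreal s\<close> by (simp add: ennreal_leI)
    next
      case top
      then show ?thesis using le b by (simp add: power2_eq_square top_unique)
    qed
  qed simp
qed (rule power_mono, auto)

lemma ennsqrt_mult: "ennsqrt (a * b) = ennsqrt a * ennsqrt b"
proof -
  have "(ennsqrt (a * b))\<^sup>2 = (ennsqrt a * ennsqrt b)\<^sup>2" by (simp add: power_mult_distrib)
  then show ?thesis by (metis ennreal_power2_le_iff order_antisym order_refl)
qed

lemma ennsqrt_mono: "a \<le> b \<Longrightarrow> ennsqrt a \<le> ennsqrt b"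
  by (subst ennreal_power2_le_iff[symmetric]) simp

lemma ennsqrt_ennreal: "0 \<le> r \<Longrightarrow> ennsqrt (ennreal r) = ennreal (sqrt r)"
  by (simp add: ennsqrt_def)

lemma Cauchy_Schwarz_ennsqrt:
  assumes [measurable]: "f \<in> borel_measurable M" "h \<in> borel_measurable M"
    "(\<lambda>x. ennsqrt (f x)) \<in> borel_measurable M" "(\<lambda>x. ennsqrt (h x)) \<in> borel_measurable M"
  shows "(\<integral>\<^sup>+x. ennsqrt (f x) * ennsqrt (h x) \<partial>M)
      \<le> ennsqrt (\<integral>\<^sup>+x. f x \<partial>M) * ennsqrt (\<integral>\<^sup>+x. h x \<partial>M)"
proof -
  have "(\<integral>\<^sup>+x. ennsqrt (f x) * ennsqrt (h x) \<partial>M)\<^sup>2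
      \<le> (ennsqrt (\<integral>\<^sup>+x. f x \<partial>M) * ennsqrt (\<integral>\<^sup>+x. h x \<partial>M))\<^sup>2"
    using Cauchy_Schwarz_nn_integral[of "\<lambda>x. ennsqrt (f x)" M "\<lambda>x. ennsqrt (h x)"]
    by (simp add: power_mult_distrib)
  then show ?thesis by (simp add: ennreal_power2_le_iff)
qed

text \<open>
  \<open>I\<close> is the Hellinger affinity of the laws of the symbols prepended to \<open>y\<close> and to
  \<open>y'\<close>. From \<open>(\<surd>p - \<surd>q)\<^sup>2 = p + q - 2 \<surd>p \<surd>q\<close> and total
  mass one, \<open>2 - 2 I\<close> is the sum of the squares of the differences of \<open>sqrt g\<close> at
  \<open>(\<sigma>, y)\<close> and \<open>(\<sigma>, y')\<close>. These points agree up to index \<open>n +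
  1\<close>, so that sum is at most the square of \<open>svar n\<close>. A bound without the factor one half
  is enough, as only convergence of the series matters.
\<close>

lemma Hellinger_bound:
  fixes g :: "(nat \<Rightarrow> 's::{countable, discrete_topology}) \<Rightarrow> real"
  assumes g: "g_function g" and agree: "\<forall>i\<le>n. y i = y' i"
  defines "I \<equiv> (\<integral>\<^sup>+\<sigma>. ennreal (sqrt (g (case_nat \<sigma> y)) * sqrt (g (case_nat \<sigma> y'))) \<partial>count_space UNIV)"
  shows "1 \<le> I + (svar n (\<lambda>x. sqrt (g x)))\<^sup>2" and "I \<le> 1"
proof -
  have nn: "0 \<le> g x" for x using g by (simp add: g_function_def)
  let ?p = "\<lambda>\<sigma>. sqrt (g (case_nat \<sigma> y))" and ?q = "\<lambda>\<sigma>. sqrt (g (case_nat \<sigma> y'))"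
  have pt: "ennreal (g (case_nat \<sigma> y)) + ennreal (g (case_nat \<sigma> y'))
      = 2 * ennreal (?p \<sigma> * ?q \<sigma>) + ennreal ((?p \<sigma> - ?q \<sigma>)\<^sup>2)" for \<sigma>
  proof -
    have "g (case_nat \<sigma> y) + g (case_nat \<sigma> y') = 2 * (?p \<sigma> * ?q \<sigma>) + (?p \<sigma> - ?q \<sigma>)\<^sup>2"
      using nn by (simp add: power2_diff)
    moreover have "ennreal (2 * (?p \<sigma> * ?q \<sigma>)) = 2 * ennreal (?p \<sigma> * ?q \<sigma>)"
      using nn by (subst ennreal_mult) auto
    moreover have "ennreal (g (case_nat \<sigma> y)) + ennreal (g (case_nat \<sigma> y'))
        = ennreal (g (case_nat \<sigma> y) + g (case_nat \<sigma> y'))"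
      using nn by (subst ennreal_plus) auto
    moreover have "ennreal (2 * (?p \<sigma> * ?q \<sigma>) + (?p \<sigma> - ?q \<sigma>)\<^sup>2)
        = ennreal (2 * (?p \<sigma> * ?q \<sigma>)) + ennreal ((?p \<sigma> - ?q \<sigma>)\<^sup>2)"
      using nn by (intro ennreal_plus) auto
    ultimately show ?thesis by simp
  qed
  have "(\<integral>\<^sup>+\<sigma>. ennreal (g (case_nat \<sigma> y)) + ennreal (g (case_nat \<sigma> y')) \<partial>count_space UNIV) = 1 + 1"
    by (subst nn_integral_add) (simp_all add: g_function_sum[OF g])
  then have two: "2 * I + (\<integral>\<^sup>+\<sigma>. ennreal ((?p \<sigma> - ?q \<sigma>)\<^sup>2) \<partial>count_space UNIV) = 2"
    unfolding pt I_def by (subst (asm) nn_integral_add) (simp_all add: nn_integral_cmult)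
  show "I \<le> 1"
  proof -
    have "2 * I \<le> 2 * I + (\<integral>\<^sup>+\<sigma>. ennreal ((?p \<sigma> - ?q \<sigma>)\<^sup>2) \<partial>count_space UNIV)" by simp
    then have "2 * I \<le> 2 * 1" unfolding two by simp
    then show ?thesis by (subst (asm) ennreal_mult_le_mult_iff) auto
  qed
  have "ennreal ((?p \<sigma> - ?q \<sigma>)\<^sup>2) \<le> (var (n + 1) (\<lambda>x. sqrt (g x)) (case_nat \<sigma> y))\<^sup>2" for \<sigma>
  proof -
    have "\<forall>i\<le>n + 1. (case_nat \<sigma> y' :: nat \<Rightarrow> 's) i = case_nat \<sigma> y i"
      using agree by (auto split: nat.split)
    then have "ennreal \<bar>?p \<sigma> - ?q \<sigma>\<bar> \<le> var (n + 1) (\<lambda>x. sqrt (g x)) (case_nat \<sigma> y)"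
      unfolding var_def by (intro SUP_upper) auto
    then have "(ennreal \<bar>?p \<sigma> - ?q \<sigma>\<bar>)\<^sup>2 \<le> (var (n + 1) (\<lambda>x. sqrt (g x)) (case_nat \<sigma> y))\<^sup>2"
      by (rule power_mono) simp
    then show ?thesis by (simp add: ennreal_power)
  qed
  then have "(\<integral>\<^sup>+\<sigma>. ennreal ((?p \<sigma> - ?q \<sigma>)\<^sup>2) \<partial>count_space UNIV)
      \<le> (\<integral>\<^sup>+\<sigma>. (var (n + 1) (\<lambda>x. sqrt (g x)) (case_nat \<sigma> y))\<^sup>2 \<partial>count_space UNIV)"
    by (intro nn_integral_mono)
  also have "\<dots> = (ennsqrt (\<Sum>\<^sub>\<infinity>\<sigma>. (var (n + 1) (\<lambda>x. sqrt (g x)) (case_nat \<sigma> y))\<^sup>2))\<^sup>2"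
    by (simp add: nn_integral_count_space_eq_infsum)
  also have "\<dots> \<le> (svar n (\<lambda>x. sqrt (g x)))\<^sup>2"
    unfolding svar_def by (intro power_mono SUP_upper) auto
  finally have "2 * I + (\<integral>\<^sup>+\<sigma>. ennreal ((?p \<sigma> - ?q \<sigma>)\<^sup>2) \<partial>count_space UNIV)
      \<le> 2 * I + (svar n (\<lambda>x. sqrt (g x)))\<^sup>2"
    by (rule add_left_mono)
  then have "2 \<le> 2 * I + (svar n (\<lambda>x. sqrt (g x)))\<^sup>2"
    by (simp only: two)
  also have "\<dots> \<le> 2 * (I + (svar n (\<lambda>x. sqrt (g x)))\<^sup>2)"
    by (simp add: distrib_left mult_2)
  finally have "2 * 1 \<le> 2 * (I + (svar n (\<lambda>x. sqrt (g x)))\<^sup>2)" by simp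
  then show "1 \<le> I + (svar n (\<lambda>x. sqrt (g x)))\<^sup>2"
    by (subst (asm) ennreal_mult_le_mult_iff) auto
qed

text \<open>
  For \<open>a = P(B)\<close> and \<open>b = P(- B)\<close> computed from the starting points \<open>x\<close>
  and \<open>x'\<close>, the sum of the two products of square roots is the Hellinger affinity of the two laws
  after merging all outcomes inside \<open>B\<close> and all outcomes outside \<open>B\<close>. The deficit
  \<open>e\<close> stands on the right-hand side to avoid truncated subtraction on \<open>ennreal\<close>.
  Formulating the property for pairs of functions, rather than for laws of words, makes it stable under the
  transfer operator.
\<close>

definition affinity_close :: "nat \<Rightarrow> ennreal \<Rightarrow> ((nat \<Rightarrow> 's) \<Rightarrow> ennreal) \<Rightarrow> ((nat \<Rightarrow> 's) \<Rightarrow> ennreal) \<Rightarrow> bool" where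
  "affinity_close n e a b \<longleftrightarrow> (\<forall>x x'. (\<forall>i\<le>n. x i = x' i) \<longrightarrow>
     1 \<le> ennsqrt (a x) * ennsqrt (a x') + ennsqrt (b x) * ennsqrt (b x') + e)"

text \<open>
  One step of the chain: by Cauchy-Schwarz, the affinity after the step is at least the sum, with weights
  \<open>sqrt (g (\<sigma>, y)) * sqrt (g (\<sigma>, y'))\<close>, of the affinities at \<open>(\<sigma>,
  y)\<close> and \<open>(\<sigma>, y')\<close>. The weights have total mass at most one, so the old deficit
  does not grow, and at least one minus the square of \<open>svar n\<close>, which is the new contribution.
  The prepended symbol is common to both points, so the agreement that is required drops from \<open>Suc
  n\<close> to \<open>n\<close>.
\<close>

lemma affinity_close_transfer:
  fixes g :: "(nat \<Rightarrow> 's::{countable, discrete_topology}) \<Rightarrow> real"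
  assumes g: "g_function g" and close: "affinity_close (Suc n) e a b"
  shows "affinity_close n (e + (svar n (\<lambda>x. sqrt (g x)))\<^sup>2) (transfer g a) (transfer g b)"
  unfolding affinity_close_def
proof (intro allI impI)
  fix y y' :: "nat \<Rightarrow> 's" assume agree: "\<forall>i\<le>n. y i = y' i"
  have nn: "0 \<le> g x" for x using g by (simp add: g_function_def)
  let ?r = "\<lambda>\<sigma>. ennreal (sqrt (g (case_nat \<sigma> y)) * sqrt (g (case_nat \<sigma> y')))"
  let ?f = "\<lambda>a \<sigma>. ennsqrt (a (case_nat \<sigma> y)) * ennsqrt (a (case_nat \<sigma> y'))"
  have C_S: "(\<integral>\<^sup>+\<sigma>. ?r \<sigma> * ?f a \<sigma> \<partial>count_space UNIV)
      \<le> ennsqrt (transfer g a y) * ennsqrt (transfer g a y')" for a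
  proof -
    have "?r \<sigma> * ?f a \<sigma> = ennsqrt (ennreal (g (case_nat \<sigma> y)) * a (case_nat \<sigma> y))
        * ennsqrt (ennreal (g (case_nat \<sigma> y')) * a (case_nat \<sigma> y'))" for \<sigma>
      using nn by (simp add: ennsqrt_mult ennsqrt_ennreal ennreal_mult mult_ac)
    then show ?thesis
      unfolding transfer_def by (simp add: Cauchy_Schwarz_ennsqrt)
  qed
  have "?r \<sigma> \<le> ?r \<sigma> * ?f a \<sigma> + ?r \<sigma> * ?f b \<sigma> + ?r \<sigma> * e" for \<sigma>
  proof -
    have "\<forall>i\<le>Suc n. (case_nat \<sigma> y :: nat \<Rightarrow> 's) i = case_nat \<sigma> y' i"
      using agree by (auto split: nat.split)
    then have "1 \<le> ?f a \<sigma> + ?f b \<sigma> + e"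
      using close unfolding affinity_close_def by blast
    then have "?r \<sigma> * 1 \<le> ?r \<sigma> * (?f a \<sigma> + ?f b \<sigma> + e)" by (intro mult_left_mono) auto
    then show ?thesis by (simp add: distrib_left)
  qed
  then have "(\<integral>\<^sup>+\<sigma>. ?r \<sigma> \<partial>count_space UNIV)
      \<le> (\<integral>\<^sup>+\<sigma>. ?r \<sigma> * ?f a \<sigma> + ?r \<sigma> * ?f b \<sigma> + ?r \<sigma> * e \<partial>count_space UNIV)"
    by (intro nn_integral_mono)
  also have "\<dots> = (\<integral>\<^sup>+\<sigma>. ?r \<sigma> * ?f a \<sigma> \<partial>count_space UNIV)
      + (\<integral>\<^sup>+\<sigma>. ?r \<sigma> * ?f b \<sigma> \<partial>count_space UNIV) + (\<integral>\<^sup>+\<sigma>. ?r \<sigma> \<partial>count_space UNIV) * e"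
    by (simp add: nn_integral_add nn_integral_multc)
  also have "\<dots> \<le> ennsqrt (transfer g a y) * ennsqrt (transfer g a y')
      + ennsqrt (transfer g b y) * ennsqrt (transfer g b y') + 1 * e"
    by (intro add_mono mult_right_mono C_S Hellinger_bound(2)[OF g agree]) auto
  finally have "(\<integral>\<^sup>+\<sigma>. ?r \<sigma> \<partial>count_space UNIV) + (svar n (\<lambda>x. sqrt (g x)))\<^sup>2
      \<le> ennsqrt (transfer g a y) * ennsqrt (transfer g a y')
      + ennsqrt (transfer g b y) * ennsqrt (transfer g b y') + 1 * e + (svar n (\<lambda>x. sqrt (g x)))\<^sup>2"
    by (rule add_right_mono)
  with Hellinger_bound(1)[OF g agree]
  show "1 \<le> ennsqrt (transfer g a y) * ennsqrt (transfer g a y')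
      + ennsqrt (transfer g b y) * ennsqrt (transfer g b y') + (e + (svar n (\<lambda>x. sqrt (g x)))\<^sup>2)"
    by (simp add: add.assoc order_trans)
qed

lemma affinity_close_transfer_iter:
  fixes g :: "(nat \<Rightarrow> 's::{countable, discrete_topology}) \<Rightarrow> real"
  assumes g: "g_function g" and "affinity_close (n + N) e a b"
  shows "affinity_close n (e + (\<Sum>k<N. (svar (n + k) (\<lambda>x. sqrt (g x)))\<^sup>2))
    ((transfer g ^^ N) a) ((transfer g ^^ N) b)"
  using assms(2)
proof (induction N arbitrary: a b e)
  case (Suc N)
  have "affinity_close (n + N) (e + (svar (n + N) (\<lambda>x. sqrt (g x)))\<^sup>2) (transfer g a) (transfer g b)"
    using affinity_close_transfer[OF g, of "n + N"] Suc.prems by simp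
  from Suc.IH[OF this] show ?case
    by (simp add: funpow_swap1 add_ac)
qed simp

text \<open>
  The hypothesis on \<open>C\<close> makes it irrelevant which of two points agreeing up to \<open>n +
  N\<close> is tested, so the initial deficit is zero.
\<close>

lemma affinity_close_indicator:
  fixes C :: "(nat \<Rightarrow> 's) set"
  assumes "determined_by {..<N} C"
  shows "affinity_close (n + N) 0 (indicator C) (indicator (- C))"
  unfolding affinity_close_def
proof (intro allI impI)
  fix x x' :: "nat \<Rightarrow> 's" assume "\<forall>i\<le>n + N. x i = x' i"
  then have "x \<in> C \<longleftrightarrow> x' \<in> C"
    using assms unfolding determined_by_def by (meson lessThan_iff less_imp_le trans_le_add2)
  moreover have "ennsqrt 1 = 1" by (simp add: ennsqrt_def)
  ultimately show "1 \<le> ennsqrt (indicator C x) * ennsqrt (indicator C x')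
      + ennsqrt (indicator (- C) x) * ennsqrt (indicator (- C) x') + 0"
    by (cases "x \<in> C") auto
qed

text \<open>
  The index \<open>n\<close> obtained is positive, since the hypothesis does not bound \<open>svar 0
  f\<close>.
\<close>

lemma svar_tail_small:
  assumes "(\<Sum>n. (svar (Suc n) f)\<^sup>2) < \<infinity>"
  shows "\<exists>n. \<forall>N. (\<Sum>k<N. (svar (n + k) f)\<^sup>2) \<le> ennreal (1 / 2)"
proof -
  define r where "r n = enn2real ((svar (Suc n) f)\<^sup>2)" for n
  have top: "(\<Sum>n. (svar (Suc n) f)\<^sup>2) \<noteq> \<top>" using assms by auto
  have fin: "(svar (Suc n) f)\<^sup>2 < \<top>" for n
    using assms ennreal_suminf_lessD[of "\<lambda>n. (svar (Suc n) f)\<^sup>2" \<top> n] by simp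
  have r: "(svar (Suc n) f)\<^sup>2 = ennreal (r n)" "0 \<le> r n" for n
    using fin[of n] by (simp_all add: r_def)
  have "summable r"
    using top r by (intro summable_suminf_not_top) auto
  from suminf_exist_split[OF _ this, of "1 / 2"] obtain m where
    m: "norm (\<Sum>i. r (i + m)) < 1 / 2" by auto
  have "(\<Sum>k<N. (svar (Suc m + k) f)\<^sup>2) \<le> ennreal (1 / 2)" for N
  proof -
    have "(\<Sum>k<N. (svar (Suc m + k) f)\<^sup>2) = ennreal (\<Sum>k<N. r (k + m))"
      using r(1)[of "_ + m"] r(2) by (simp add: add.commute flip: sum_ennreal)
    also have "(\<Sum>k<N. r (k + m)) \<le> (\<Sum>i. r (i + m))"
      using \<open>summable r\<close> r(2) by (intro sum_le_suminf) (auto simp: summable_iff_shift)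
    also have "\<dots> \<le> 1 / 2" using m by simp
    finally show ?thesis by (simp add: ennreal_leI)
  qed
  then show ?thesis by blast
qed

text \<open>
  If the run from \<open>y\<close> ends outside \<open>C\<close>, and the run from \<open>y'\<close> inside
  \<open>C\<close>, with probability at most \<open>1/25\<close>, then both products of square roots in the
  affinity are at most \<open>1/5\<close>. With a deficit of at most \<open>1/2\<close> this gives \<open>1
  \<le> 1/5 + 1/5 + 1/2\<close>, which is absurd.
\<close>

lemma pasts_not_separated:
  fixes g :: "(nat \<Rightarrow> 's::{countable, discrete_topology}) \<Rightarrow> real"
  assumes g: "g_function g"
    and tail: "(\<Sum>k<N. (svar (n + k) (\<lambda>x. sqrt (g x)))\<^sup>2) \<le> ennreal (1 / 2)"
    and C: "determined_by {..<N} C" and agree: "\<forall>i\<le>n. y i = y' i"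
    and y: "(transfer g ^^ N) (indicator (- C)) y \<le> ennreal (1 / 25)"
  shows "(transfer g ^^ N) (indicator C) y' > ennreal (1 / 25)"
proof (rule ccontr)
  assume "\<not> ?thesis"
  then have y': "(transfer g ^^ N) (indicator C) y' \<le> ennreal (1 / 25)" by simp
  let ?u = "(transfer g ^^ N) (indicator C)" and ?v = "(transfer g ^^ N) (indicator (- C))"
  have le1: "ennsqrt (?u x) \<le> 1" "ennsqrt (?v x) \<le> 1" for x
  proof -
    have one: "ennsqrt 1 = 1" by (simp add: ennsqrt_def)
    have "?u x \<le> 1" "?v x \<le> 1"
      by (intro transfer_iter_le_one[OF g]; simp split: split_indicator)+
    from this[THEN ennsqrt_mono] show "ennsqrt (?u x) \<le> 1" "ennsqrt (?v x) \<le> 1"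
      by (simp_all only: one)
  qed
  have fifth: "ennsqrt (ennreal (1 / 25)) = ennreal (1 / 5)"
  proof -
    have "sqrt (1 / 25) = 1 / 5" by (rule real_sqrt_unique) (auto simp: power2_eq_square)
    then show ?thesis by (simp only: ennsqrt_ennreal)
  qed
  have "1 \<le> ennsqrt (?u y) * ennsqrt (?u y') + ennsqrt (?v y) * ennsqrt (?v y')
      + (0 + (\<Sum>k<N. (svar (n + k) (\<lambda>x. sqrt (g x)))\<^sup>2))"
    using affinity_close_transfer_iter[OF g affinity_close_indicator[OF C]] agree
    unfolding affinity_close_def by blast
  also have "\<dots> \<le> 1 * ennreal (1 / 5) + ennreal (1 / 5) * 1 + (0 + ennreal (1 / 2))"
    using ennsqrt_mono[OF y] ennsqrt_mono[OF y'] le1 tail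
    by (intro add_mono mult_mono) (auto simp: fifth)
  also have "\<dots> = ennreal (9 / 10)"
  proof -
    have "ennreal (9 / 10) = ennreal (1 / 5 + 1 / 5 + 1 / 2)" by simp
    also have "\<dots> = ennreal (1 / 5 + 1 / 5) + ennreal (1 / 2)" by (rule ennreal_plus) auto
    also have "ennreal (1 / 5 + 1 / 5) = ennreal (1 / 5) + ennreal (1 / 5)" by (rule ennreal_plus) auto
    finally show ?thesis by simp
  qed
  finally have "ennreal 1 \<le> ennreal (9 / 10)" by simp
  then show False by (subst (asm) ennreal_le_iff) auto
qed

section \<open>Stationary measures are ergodic\<close>

definition stationary ::
  "((nat \<Rightarrow> 's::{countable, discrete_topology}) \<Rightarrow> real) \<Rightarrow> (nat \<Rightarrow> 's) measure \<Rightarrow> bool" where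
  "stationary g M \<longleftrightarrow> sets M = sets borel \<and> finite_measure M \<and>
     (\<forall>f\<in>borel_measurable borel. (\<integral>\<^sup>+y. transfer g f y \<partial>M) = (\<integral>\<^sup>+y. f y \<partial>M))"

lemma stationary_iter:
  assumes "g \<in> borel_measurable borel" "stationary g M" "f \<in> borel_measurable borel"
  shows "(\<integral>\<^sup>+y. (transfer g ^^ N) f y \<partial>M) = (\<integral>\<^sup>+y. f y \<partial>M)"
proof (induction N)
  case (Suc N)
  then show ?case
    using assms(2) borel_measurable_transfer_iter[OF assms(1,3), of N]
    by (simp add: stationary_def)
qed simp

lemma measurable_tail [measurable]:
  "(\<lambda>x. x \<circ> Suc) \<in> (borel :: (nat \<Rightarrow> 's::topological_space) measure) \<rightarrow>\<^sub>M borel"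
  by (intro borel_measurable_continuous_onI continuous_on_coordinatewise_then_product) auto

text \<open>
  Taking \<open>f = 1\<close> shows that a stationary measure is invariant under dropping the first symbol. In
  general the identity says that the transfer operator is adjoint to composition with the tail map.
\<close>

lemma stationary_tail:
  fixes M :: "(nat \<Rightarrow> 's::{countable, discrete_topology}) measure"
  assumes M: "stationary g M"
    and [measurable]: "u \<in> borel_measurable borel" "f \<in> borel_measurable borel"
  shows "(\<integral>\<^sup>+x. u x * transfer g f x \<partial>M) = (\<integral>\<^sup>+x. u (x \<circ> Suc) * f x \<partial>M)"
proof -
  have "(\<lambda>x. u (x \<circ> Suc) * f x) \<in> borel_measurable borel" by measurable
  then have "(\<integral>\<^sup>+x. transfer g (\<lambda>x. u (x \<circ> Suc) * f x) x \<partial>M) = (\<integral>\<^sup>+x. u (x \<circ> Suc) * f x \<partial>M)"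
    using M by (simp add: stationary_def)
  then show ?thesis by (simp add: transfer_tail)
qed

text \<open>
  The chain moves backwards along the orbits of the tail map, so it never leaves a set that is invariant under
  that map.
\<close>

lemma stationary_restrict:
  fixes M :: "(nat \<Rightarrow> 's::{countable, discrete_topology}) measure"
  assumes g: "g \<in> borel_measurable borel" and M: "stationary g M" and A: "A \<in> sets borel"
    and inv: "AE x in M. x \<circ> Suc \<in> A \<longleftrightarrow> x \<in> A"
  shows "stationary g (density M (indicator A))"
proof -
  have sets_M [measurable_cong]: "sets M = sets borel" using M by (simp add: stationary_def)
  interpret finite_measure M using M by (simp add: stationary_def)
  have [measurable]: "A \<in> sets borel" by fact
  have "finite_measure (density M (indicator A))"
    by (rule finite_measure_restricted) (simp add: sets_M)
  moreover have "(\<integral>\<^sup>+y. transfer g f y \<partial>density M (indicator A))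
      = (\<integral>\<^sup>+y. f y \<partial>density M (indicator A))"
    if [measurable]: "f \<in> borel_measurable borel" for f :: "(nat \<Rightarrow> 's) \<Rightarrow> ennreal"
  proof -
    have [measurable]: "transfer g f \<in> borel_measurable borel"
      using g that by (rule borel_measurable_transfer)
    have "(\<integral>\<^sup>+y. transfer g f y \<partial>density M (indicator A))
        = (\<integral>\<^sup>+y. indicator A y * transfer g f y \<partial>M)"
      by (subst nn_integral_density) auto
    also have "\<dots> = (\<integral>\<^sup>+x. indicator A (x \<circ> Suc) * f x \<partial>M)"
      by (rule stationary_tail[OF M]) auto
    also have "\<dots> = (\<integral>\<^sup>+x. indicator A x * f x \<partial>M)"
      using inv by (intro nn_integral_cong_AE) (auto elim!: eventually_mono split: split_indicator)
    also have "\<dots> = (\<integral>\<^sup>+y. f y \<partial>density M (indicator A))"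
      by (subst nn_integral_density) auto
    finally show ?thesis .
  qed
  ultimately show ?thesis by (simp add: stationary_def sets_M)
qed

lemma sets_cylinder:
  fixes c :: "'s::{countable, discrete_topology}"
  shows "{x. \<forall>i\<le>n. x i = c} \<in> sets (borel :: (nat \<Rightarrow> 's) measure)"
proof -
  have "determined_by {..n} {x :: nat \<Rightarrow> 's. \<forall>i\<le>n. x i = c}"
    by (simp add: determined_by_def)
  then show ?thesis by (intro borel_open open_determined_by) auto
qed

lemma stationary_cylinder_pos:
  fixes M :: "(nat \<Rightarrow> 's::{countable, discrete_topology}) measure"
  assumes g: "g \<in> borel_measurable borel" "\<And>x. g x > 0"
    and M: "stationary g M" "emeasure M UNIV \<noteq> 0"
  shows "emeasure M {x. \<forall>i\<le>n. x i = c} > 0"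
proof (rule ccontr)
  let ?W = "{x. \<forall>i\<le>n. x i = c}"
  have sets_M: "sets M = sets borel" using M(1) by (simp add: stationary_def)
  have sp: "space M = UNIV" using sets_eq_imp_space_eq[OF sets_M] by simp
  assume "\<not> emeasure M ?W > 0"
  then have "emeasure M ?W = 0" by simp
  moreover have "(\<integral>\<^sup>+y. (transfer g ^^ Suc n) (indicator ?W) y \<partial>M) = emeasure M ?W"
    using stationary_iter[OF g(1) M(1), of "indicator ?W" "Suc n"] sets_cylinder
    by (simp add: sets_M)
  ultimately have "(\<integral>\<^sup>+y. (transfer g ^^ Suc n) (indicator ?W) y \<partial>M) = 0" by simp
  moreover have "(transfer g ^^ Suc n) (indicator ?W) \<in> borel_measurable M"
    using borel_measurable_transfer_iter[OF g(1), of "indicator ?W" "Suc n"] sets_cylinder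
    by (simp add: measurable_cong_sets[OF sets_M refl])
  ultimately have null: "AE y in M. (transfer g ^^ Suc n) (indicator ?W) y = 0"
    by (simp add: nn_integral_0_iff_AE)
  have pos: "(transfer g ^^ Suc n) (indicator ?W) y > 0" for y
    by (rule transfer_iter_pos[OF g(2), where c = c]) (auto simp: less_Suc_eq_le)
  from null have "AE y in M. False"
  proof eventually_elim
    case (elim y)
    then show ?case using pos[of y] by (simp del: funpow.simps)
  qed
  then have "emeasure M {y \<in> space M. True} = 0" by (intro emeasure_eq_0_AE) simp
  then show False using M(2) by (simp add: sp)
qed

text \<open>
  The \<open>M\<close>-average of the probability of being in \<open>D\<close> after \<open>N\<close> steps is
  the measure of \<open>D\<close>, so by Markov's inequality this probability cannot exceed \<open>t\<close>
  on all of \<open>W\<close>.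
\<close>

lemma stationary_Markov:
  fixes M :: "(nat \<Rightarrow> 's::{countable, discrete_topology}) measure"
  assumes g: "g \<in> borel_measurable borel" and M: "stationary g M"
    and D: "D \<in> sets borel" and W: "W \<in> sets borel"
    and small: "emeasure M D < t * emeasure M W"
  shows "\<exists>y\<in>W. (transfer g ^^ N) (indicator D) y \<le> t"
proof (rule ccontr)
  assume "\<not> ?thesis"
  then have "t * indicator W y \<le> (transfer g ^^ N) (indicator D) y" for y
    by (cases "y \<in> W") (auto simp: not_le intro: less_imp_le)
  then have "(\<integral>\<^sup>+y. t * indicator W y \<partial>M) \<le> (\<integral>\<^sup>+y. (transfer g ^^ N) (indicator D) y \<partial>M)"
    by (intro nn_integral_mono)
  also have "\<dots> = emeasure M D"
    using stationary_iter[OF g M, of "indicator D"] D M by (simp add: stationary_def)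
  finally show False
    using small W M by (simp add: stationary_def nn_integral_cmult_indicator)
qed

lemma stationary_ergodic:
  fixes g :: "(nat \<Rightarrow> 's::{countable, discrete_topology}) \<Rightarrow> real"
  assumes g: "g_function g" "\<And>x. g x > 0"
    and var: "(\<Sum>n. (svar (Suc n) (\<lambda>x. sqrt (g x)))\<^sup>2) < \<infinity>"
    and M: "stationary g M" and A: "A \<in> sets borel"
    and inv: "AE x in M. x \<circ> Suc \<in> A \<longleftrightarrow> x \<in> A"
  shows "emeasure M A = 0 \<or> emeasure M (- A) = 0"
proof (rule ccontr)
  assume non_null: "\<not> ?thesis"
  have g_meas: "g \<in> borel_measurable borel" using g(1) by (simp add: g_function_def)
  have sets_M: "sets M = sets borel" using M by (simp add: stationary_def)
  interpret finite_measure M using M by (simp add: stationary_def)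
  define K where "K = density M (indicator A)"
  define L where "L = density M (indicator (- A))"
  have K: "stationary g K" and L: "stationary g L"
    unfolding K_def L_def using A inv
    by (auto intro!: stationary_restrict[OF g_meas M] elim!: eventually_mono)
  have emeasure_K: "emeasure K B = emeasure M (A \<inter> B)" and emeasure_L: "emeasure L B = emeasure M (- A \<inter> B)"
    if "B \<in> sets borel" for B
    using A that by (auto simp: K_def L_def sets_M emeasure_restricted)
  obtain n where n: "\<And>N. (\<Sum>k<N. (svar (n + k) (\<lambda>x. sqrt (g x)))\<^sup>2) \<le> ennreal (1 / 2)"
    using svar_tail_small[OF var] by blast
  \<comment> \<open>Any word of length \<open>n + 1\<close> would do; a constant one makes the cylinder easy to reach.\<close>
  define W where "W = {x :: nat \<Rightarrow> 's. \<forall>i\<le>n. x i = undefined}"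
  have W: "W \<in> sets borel" unfolding W_def by (rule sets_cylinder)
  have "emeasure K W > 0" "emeasure L W > 0"
    unfolding W_def using non_null emeasure_K[of UNIV] emeasure_L[of UNIV]
    by (simp_all add: stationary_cylinder_pos[OF g_meas g(2)] K L)
  then have pos: "measure K W > 0" "measure L W > 0"
    using K L by (auto simp: stationary_def finite_measure.emeasure_eq_measure)
  \<comment> \<open>Small enough for the Markov inequality to give probabilities at most \<open>1 / 25\<close> on \<open>W\<close> under both restrictions.\<close>
  define e where "e = min (measure K W) (measure L W) / 25"
  have "e > 0" using pos by (simp add: e_def)
  from approximation_by_determined[OF _ sets_M A this] obtain J C where
    JC: "finite J" "determined_by J C" "measure M ((A - C) \<union> (C - A)) < e"
    using finite_measure_axioms by blast
  obtain N where "J \<subseteq> {..<N}" using finite_nat_iff_bounded JC(1) by blast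
  with JC(2) have C: "determined_by {..<N} C" by (rule determined_by_mono)
  have C_sets: "C \<in> sets borel" by (rule borel_open, rule open_determined_by[OF _ C]) simp
  have "measure M (A - C) < e" "measure M (C - A) < e"
    using JC(3) finite_measure_mono[of "A - C" "(A - C) \<union> (C - A)"]
      finite_measure_mono[of "C - A" "(A - C) \<union> (C - A)"] A C_sets
    by (auto simp: sets_M)
  then have "emeasure K (- C) < ennreal e" "emeasure L C < ennreal e"
    using C_sets \<open>e > 0\<close>
    by (auto simp: emeasure_K emeasure_L emeasure_eq_measure Diff_eq Int_commute ennreal_lessI)
  moreover have "ennreal e \<le> ennreal (1 / 25) * emeasure K W" "ennreal e \<le> ennreal (1 / 25) * emeasure L W"
    using K L by (auto simp: stationary_def finite_measure.emeasure_eq_measure e_def ennreal_leI simp flip: ennreal_mult)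
  ultimately have small: "emeasure K (- C) < ennreal (1 / 25) * emeasure K W"
    "emeasure L C < ennreal (1 / 25) * emeasure L W"
    by (auto intro: less_le_trans)
  obtain y where y: "y \<in> W" "(transfer g ^^ N) (indicator (- C)) y \<le> ennreal (1 / 25)"
    using stationary_Markov[OF g_meas K _ W small(1)] C_sets by auto
  obtain y' where y': "y' \<in> W" "(transfer g ^^ N) (indicator C) y' \<le> ennreal (1 / 25)"
    using stationary_Markov[OF g_meas L C_sets W small(2)] by auto
  have "\<forall>i\<le>n. y i = y' i" using y(1) y'(1) by (simp add: W_def)
  from pasts_not_separated[OF g(1) n C this y(2)] y'(2) show False by simp
qed

section \<open>Uniqueness of the stationary measure\<close>

text \<open>
  The inequality for the complement of \<open>B\<close> is the reverse inequality for \<open>B\<close>.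
\<close>

lemma prob_measures_eq_if_le:
  assumes "prob_space M" "prob_space M'" "sets M = sets M'"
    and le: "\<And>B. B \<in> sets M \<Longrightarrow> emeasure M B \<le> emeasure M' B"
  shows "M = M'"
proof (rule measure_eqI)
  interpret M: prob_space M by fact
  interpret M': prob_space M' by fact
  fix B assume B: "B \<in> sets M"
  have sp: "space M = space M'" using assms(3) by (rule sets_eq_imp_space_eq)
  have le_real: "measure M D \<le> measure M' D" if "D \<in> sets M" for D
    using le[OF that] by (simp add: M.emeasure_eq_measure M'.emeasure_eq_measure)
  have "measure M (space M - B) = 1 - measure M B" "measure M' (space M - B) = 1 - measure M' B"
    using B M.prob_compl[of B] M'.prob_compl[of B] assms(3) sp by auto
  then show "emeasure M B = emeasure M' B"
    using le_real[OF B] le_real[of "space M - B"] B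
    by (simp add: M.emeasure_eq_measure M'.emeasure_eq_measure)
qed fact

text \<open>
  The average of two probability measures is the law obtained by tossing a fair coin to decide from which of
  the two to sample.
\<close>

lemma midpoint_measure:
  assumes "prob_space M" "prob_space M'" "sets M = sets B" "sets M' = sets B"
  shows "\<exists>R. prob_space R \<and> sets R = sets B \<and> (\<forall>f\<in>borel_measurable B.
      (\<integral>\<^sup>+x. f x \<partial>R) = ((\<integral>\<^sup>+x. f x \<partial>M) + (\<integral>\<^sup>+x. f x \<partial>M')) * ennreal (1 / 2))"
proof -
  let ?b = "measure_pmf (bernoulli_pmf (1 / 2))"
  define R where "R = ?b \<bind> (\<lambda>b. if b then M else M')"
  have kernel: "(\<lambda>b. if b then M else M') \<in> ?b \<rightarrow>\<^sub>M subprob_algebra B"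
  proof -
    have "M \<in> space (subprob_algebra B)" "M' \<in> space (subprob_algebra B)"
      using assms by (simp_all add: space_subprob_algebra prob_space_imp_subprob_space)
    then show ?thesis by (simp add: Pi_iff)
  qed
  have int: "(\<integral>\<^sup>+x. f x \<partial>R) = ((\<integral>\<^sup>+x. f x \<partial>M) + (\<integral>\<^sup>+x. f x \<partial>M')) * ennreal (1 / 2)"
    if "f \<in> borel_measurable B" for f
    unfolding R_def nn_integral_bind[OF that kernel]
    by (simp add: distrib_right)
  have sets_R: "sets R = sets B"
    unfolding R_def by (rule sets_bind) (simp_all add: assms)
  moreover have "prob_space R"
    unfolding R_def
    by (rule measure_pmf.prob_space_bind[OF AE_I2 kernel]) (simp add: assms)
  ultimately show ?thesis using int by blast
qed

text \<open>
  Let \<open>R\<close> be the average of \<open>M\<close> and \<open>M'\<close>, and \<open>h\<close> the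
  density of \<open>M\<close> with respect to \<open>R\<close>. As both \<open>M\<close> and \<open>R\<close>
  are stationary, duality shows that \<open>h\<close> and its composition with the tail map are densities of
  the same measure. So the set where \<open>h > 1\<close> is invariant, and by ergodicity \<open>h \<le>
  1\<close> or \<open>h > 1\<close> almost everywhere. Either way \<open>M\<close> and \<open>R\<close> are
  comparable, hence equal.
\<close>

lemma stationary_unique:
  fixes g :: "(nat \<Rightarrow> 's::{countable, discrete_topology}) \<Rightarrow> real"
  assumes g: "g_function g" "\<And>x. g x > 0"
    and var: "(\<Sum>n. (svar (Suc n) (\<lambda>x. sqrt (g x)))\<^sup>2) < \<infinity>"
    and M: "stationary g M" "prob_space M" and M': "stationary g M'" "prob_space M'"
  shows "M = M'"
proof -
  have g_meas: "g \<in> borel_measurable borel" using g(1) by (simp add: g_function_def)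
  have sets_M: "sets M = sets borel" "sets M' = sets borel"
    using M(1) M'(1) by (auto simp: stationary_def)
  obtain R where R: "prob_space R" "sets R = sets borel"
    and R_int: "\<And>f :: _ \<Rightarrow> ennreal. f \<in> borel_measurable borel \<Longrightarrow>
      (\<integral>\<^sup>+x. f x \<partial>R) = ((\<integral>\<^sup>+x. f x \<partial>M) + (\<integral>\<^sup>+x. f x \<partial>M')) * ennreal (1 / 2)"
    using midpoint_measure[OF M(2) M'(2) sets_M] by blast
  interpret R: prob_space R by fact
  have [measurable_cong]: "sets R = sets borel" by fact
  have R_stat: "stationary g R"
    using M(1) M'(1) R_int R(2) R.finite_measure_axioms borel_measurable_transfer[OF g_meas]
    by (simp add: stationary_def)
  have R_emeasure: "emeasure R B = (emeasure M B + emeasure M' B) * ennreal (1 / 2)"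
    if "B \<in> sets borel" for B
    using R_int[of "indicator B"] that R(2) sets_M by simp
  have "absolutely_continuous R M"
    using R_emeasure R(2) sets_M by (auto simp: absolutely_continuous_def null_sets_def)
  from R.Radon_Nikodym[OF this] sets_M R(2) obtain h where
    h: "h \<in> borel_measurable borel" and M_eq: "density R h = M"
    by (auto simp: measurable_cong_sets[OF R(2) refl])
  note [measurable] = h
  have M_int: "(\<integral>\<^sup>+x. f x \<partial>M) = (\<integral>\<^sup>+x. h x * f x \<partial>R)"
    if [measurable]: "f \<in> borel_measurable borel" for f
    unfolding M_eq[symmetric] by (subst nn_integral_density) auto
  have M_emeasure: "emeasure M B = (\<integral>\<^sup>+x. h x * indicator B x \<partial>R)" if "B \<in> sets borel" for B
    using M_int[of "indicator B"] that sets_M by simp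
  have h_inv: "AE x in R. h (x \<circ> Suc) = h x"
  proof (rule R.density_unique_finite_measure)
    fix B assume "B \<in> sets R"
    then have [measurable]: "B \<in> sets borel" using R(2) by simp
    have [measurable]: "transfer g (indicator B) \<in> borel_measurable borel"
      by (intro borel_measurable_transfer g_meas) auto
    have "(\<integral>\<^sup>+x. h (x \<circ> Suc) * indicator B x \<partial>R) = (\<integral>\<^sup>+x. h x * transfer g (indicator B) x \<partial>R)"
      by (rule stationary_tail[OF R_stat, symmetric]) auto
    also have "\<dots> = (\<integral>\<^sup>+x. transfer g (indicator B) x \<partial>M)"
      by (rule M_int[symmetric]) auto
    also have "\<dots> = (\<integral>\<^sup>+x. indicator B x \<partial>M)"
      using M(1) by (simp add: stationary_def)
    also have "\<dots> = (\<integral>\<^sup>+x. h x * indicator B x \<partial>R)"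
      by (rule M_int) auto
    finally show "(\<integral>\<^sup>+x. h (x \<circ> Suc) * indicator B x \<partial>R) = (\<integral>\<^sup>+x. h x * indicator B x \<partial>R)" .
  qed auto
  define A where "A = {x. 1 < h x}"
  have A: "A \<in> sets borel" unfolding A_def by measurable
  have "AE x in R. x \<circ> Suc \<in> A \<longleftrightarrow> x \<in> A"
    using h_inv by eventually_elim (simp add: A_def)
  from stationary_ergodic[OF g var R_stat A this] have "M = R"
  proof
    assume "emeasure R A = 0"
    then have le: "AE x in R. h x \<le> 1"
      using A R(2) by (intro AE_I'[of A]) (auto simp: null_sets_def A_def not_le)
    have "emeasure M B \<le> emeasure R B" if "B \<in> sets borel" for B
    proof -
      have "emeasure M B \<le> (\<integral>\<^sup>+x. indicator B x \<partial>R)"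
        unfolding M_emeasure[OF that]
        by (intro nn_integral_mono_AE) (use le in eventually_elim, auto split: split_indicator)
      then show ?thesis using that R(2) by simp
    qed
    then show ?thesis
      using prob_measures_eq_if_le[OF M(2) R(1)] sets_M R(2) by simp
  next
    assume "emeasure R (- A) = 0"
    then have le: "AE x in R. 1 \<le> h x"
      using A R(2) by (intro AE_I'[of "- A"]) (auto simp: null_sets_def A_def not_le)
    have "emeasure R B \<le> emeasure M B" if "B \<in> sets borel" for B
    proof -
      have "(\<integral>\<^sup>+x. indicator B x \<partial>R) \<le> emeasure M B"
        unfolding M_emeasure[OF that]
        by (intro nn_integral_mono_AE) (use le in eventually_elim, auto split: split_indicator)
      then show ?thesis using that R(2) by simp
    qed
    then show ?thesis
      using prob_measures_eq_if_le[OF R(1) M(2)] sets_M R(2) by simp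
  qed
  show "M = M'"
  proof (rule measure_eqI)
    fix B assume "B \<in> sets M"
    then have B: "B \<in> sets borel" using sets_M by simp
    interpret M: prob_space M by fact
    interpret M': prob_space M' by fact
    have "ennreal ((measure M B + measure M' B) * (1 / 2))
        = (ennreal (measure M B) + ennreal (measure M' B)) * ennreal (1 / 2)"
      by (subst ennreal_mult) (auto simp: ennreal_plus)
    also have "\<dots> = ennreal (measure M B)"
      using R_emeasure[OF B] unfolding \<open>M = R\<close>[symmetric]
      by (simp only: M.emeasure_eq_measure M'.emeasure_eq_measure)
    finally have "(measure M B + measure M' B) * (1 / 2) = measure M B"
      by (subst (asm) ennreal_inj) auto
    then show "emeasure M B = emeasure M' B"
      by (simp add: M.emeasure_eq_measure M'.emeasure_eq_measure)
  qed (simp add: sets_M)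
qed

section \<open>From two-sided to one-sided sequences\<close>

lemma measurable_future [measurable]:
  "future \<in> (borel :: (int \<Rightarrow> 's::topological_space) measure) \<rightarrow>\<^sub>M borel"
  unfolding future_def
  by (intro borel_measurable_continuous_onI continuous_on_coordinatewise_then_product) auto

lemma measurable_shift [measurable]:
  "shift \<in> (borel :: (int \<Rightarrow> 's::topological_space) measure) \<rightarrow>\<^sub>M borel"
  unfolding shift_def
  by (intro borel_measurable_continuous_onI continuous_on_coordinatewise_then_product) auto

lemma distr_shift_iter:
  fixes \<mu> :: "(int \<Rightarrow> 's::topological_space) measure"
  assumes "distr \<mu> borel shift = \<mu>" "sets \<mu> = sets borel" "B \<in> sets borel"
  shows "emeasure \<mu> ((shift ^^ k) -` B) = emeasure \<mu> B"
  using assms(3)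
proof (induction k arbitrary: B)
  case (Suc k)
  have sp: "space \<mu> = UNIV" using sets_eq_imp_space_eq[OF assms(2)] by simp
  have m: "shift \<in> \<mu> \<rightarrow>\<^sub>M borel" by (simp add: measurable_cong_sets[OF assms(2) refl])
  have "shift -` B \<in> sets borel" using measurable_sets[OF measurable_shift Suc.prems] by simp
  then have "emeasure \<mu> ((shift ^^ k) -` (shift -` B)) = emeasure \<mu> (shift -` B)"
    by (rule Suc.IH)
  also have "\<dots> = emeasure (distr \<mu> borel shift) B"
    using Suc.prems by (simp add: emeasure_distr[OF m] sp)
  finally show ?case using assms(1) by (simp add: vimage_def)
qed simp

lemma shift_iter: "(shift ^^ k) x = (\<lambda>i. x (i + int k))"
  by (induction k) (auto simp: shift_def algebra_simps)

text \<open>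
  A set that depends on finitely many coordinates is moved by a sufficiently high power of the shift into the
  positive coordinates, where the marginal determines its measure.
\<close>

lemma shift_invariant_eq_if_future_eq:
  fixes \<mu> \<nu> :: "(int \<Rightarrow> 's::discrete_topology) measure"
  assumes \<mu>: "prob_space \<mu>" "sets \<mu> = sets borel" "distr \<mu> borel shift = \<mu>"
    and \<nu>: "prob_space \<nu>" "sets \<nu> = sets borel" "distr \<nu> borel shift = \<nu>"
    and eq: "distr \<mu> borel future = distr \<nu> borel future"
  shows "\<mu> = \<nu>"
proof (rule measure_eqI_generator_eq[where \<Omega> = UNIV and A = "\<lambda>_. UNIV"])
  let ?G = "{C :: (int \<Rightarrow> 's) set. \<exists>J. finite J \<and> determined_by J C}"
  show "Int_stable ?G"
  proof (rule Int_stableI)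
    fix C D assume "C \<in> ?G" "D \<in> ?G"
    then obtain J K where "finite J" "determined_by J C" "finite K" "determined_by K D" by blast
    then have "finite (J \<union> K)" "determined_by (J \<union> K) (C \<inter> D)"
      by (auto intro: determined_by_Int)
    then show "C \<inter> D \<in> ?G" by blast
  qed
  show "sets \<mu> = sigma_sets UNIV ?G" "sets \<nu> = sigma_sets UNIV ?G"
    using \<mu> \<nu> sets_borel_determined_by by auto
  have "determined_by {} (UNIV :: (int \<Rightarrow> 's) set)" by (simp add: determined_by_def)
  then show "range (\<lambda>_. UNIV) \<subseteq> ?G" by blast
  show "emeasure \<mu> UNIV \<noteq> \<infinity>" for i :: nat
    using prob_space.emeasure_space_1[OF \<mu>(1)] sets_eq_imp_space_eq[OF \<mu>(2)] by simp
  fix C assume "C \<in> ?G"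
  then obtain J where J: "finite J" "determined_by J C" by blast
  then have C: "C \<in> sets borel" by (intro borel_open open_determined_by)
  obtain k :: nat where k: "\<forall>i\<in>J. 1 \<le> i + int k"
  proof -
    obtain b where "\<forall>i\<in>J. b \<le> i" using bdd_below_finite[OF J(1)] by (auto simp: bdd_below_def)
    then show thesis by (intro that[of "nat (1 - b)"]) force
  qed
  \<comment> \<open>The set \<open>C\<close> moved \<open>k\<close> places to the right; the offset \<open>- 1\<close> is there because \<open>future\<close> starts at the coordinate \<open>1\<close>.\<close>
  define D where "D = {y :: nat \<Rightarrow> 's. (\<lambda>i. y (nat (i + int k - 1))) \<in> C}"
  have "determined_by ((\<lambda>i. nat (i + int k - 1)) ` J) D"
    using J(2) unfolding determined_by_def D_def by auto
  then have D: "D \<in> sets borel" using J(1) by (intro borel_open open_determined_by[of _ D]) auto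
  have preimage: "(shift ^^ k) -` C = future -` D"
  proof -
    have "(shift ^^ k) x \<in> C \<longleftrightarrow> future x \<in> D" for x
    proof -
      have "\<forall>i\<in>J. (shift ^^ k) x i = future x (nat (i + int k - 1))"
        using k by (auto simp: shift_iter future_def)
      then show ?thesis
        using J(2) unfolding determined_by_def D_def by auto
    qed
    then show ?thesis by auto
  qed
  have "emeasure \<kappa> C = emeasure (distr \<kappa> borel future) D"
    if "sets \<kappa> = sets borel" "distr \<kappa> borel shift = \<kappa>" for \<kappa> :: "(int \<Rightarrow> 's) measure"
  proof -
    have "future \<in> \<kappa> \<rightarrow>\<^sub>M borel" by (simp add: measurable_cong_sets[OF that(1) refl])
    then have "emeasure (distr \<kappa> borel future) D = emeasure \<kappa> (future -` D)"
      using D sets_eq_imp_space_eq[OF that(1)] by (simp add: emeasure_distr)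
    then show ?thesis
      using distr_shift_iter[OF that(2,1) C, of k] by (simp add: preimage)
  qed
  then show "emeasure \<mu> C = emeasure \<nu> C" using \<mu> \<nu> eq by simp
qed auto

text \<open>
  The defining property of a \<open>g\<close>-measure as an identity of integrals: on sets that depend on the
  future it is the characteristic property of conditional expectations, and an equality of measures extends it
  to nonnegative functions \<open>u\<close>.
\<close>

lemma g_measure_past_symbol:
  fixes g :: "(nat \<Rightarrow> 's::{countable, discrete_topology}) \<Rightarrow> real"
  assumes g: "g_function g" and \<mu>: "g_measure g \<mu>" and [measurable]: "u \<in> borel_measurable borel"
  shows "(\<integral>\<^sup>+x. indicator {x. x 0 = \<sigma>} x * u (future x) \<partial>\<mu>)
    = (\<integral>\<^sup>+x. ennreal (g (case_nat \<sigma> (future x))) * u (future x) \<partial>\<mu>)"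
proof -
  have sets_\<mu> [measurable_cong]: "sets \<mu> = sets borel" and prob: "prob_space \<mu>"
    and cond: "AE x in \<mu>. real_cond_exp \<mu> (vimage_algebra UNIV future borel) (indicator {x. x 0 = \<sigma>}) x
          = g (case_nat \<sigma> (future x))"
    using \<mu> by (auto simp: g_measure_def)
  interpret prob_space \<mu> by fact
  have sp: "space \<mu> = UNIV" using sets_eq_imp_space_eq[OF sets_\<mu>] by simp
  have g_meas [measurable]: "g \<in> borel_measurable borel" and g_bounds: "\<And>x. 0 \<le> g x" "\<And>x. g x \<le> 1"
    using g by (auto simp: g_function_def)
  let ?F = "vimage_algebra UNIV (future :: (int \<Rightarrow> 's) \<Rightarrow> _) borel"
  let ?E = "{x :: int \<Rightarrow> 's. x 0 = \<sigma>}"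
  have E [measurable]: "?E \<in> sets \<mu>"
    unfolding sets_\<mu> by (intro borel_open open_coordinate_fixed)
  have sub: "subalgebra \<mu> ?F"
    unfolding subalgebra_def sp sets_\<mu>
    using measurable_sets[OF measurable_future] by (auto simp: sets_vimage_algebra2)
  interpret F: finite_measure_subalgebra \<mu> ?F
    by unfold_locales (rule sub)
  have E_fut: "emeasure \<mu> (?E \<inter> future -` B)
      = (\<integral>\<^sup>+x. ennreal (g (case_nat \<sigma> (future x))) * indicator B (future x) \<partial>\<mu>)"
    if [measurable]: "B \<in> sets borel" for B
  proof -
    have B: "future -` B \<in> sets ?F" using in_vimage_algebra[OF that, of future UNIV] by simp
    have B' [measurable]: "future -` B \<in> sets \<mu>" using B sub by (auto simp: subalgebra_def)
    have "measure \<mu> (?E \<inter> future -` B) = (\<integral>x. indicator (?E \<inter> future -` B) x \<partial>\<mu>)"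
      by (simp add: sp)
    also have "\<dots> = (\<integral>x\<in>future -` B. indicator ?E x \<partial>\<mu>)"
      unfolding set_lebesgue_integral_def
      by (intro Bochner_Integration.integral_cong) (auto split: split_indicator)
    also have "\<dots> = (\<integral>x\<in>future -` B. real_cond_exp \<mu> ?F (indicator ?E) x \<partial>\<mu>)"
      by (rule F.real_cond_exp_intA[OF _ B]) (simp add: integrable_real_indicator emeasure_eq_measure)
    also have "\<dots> = (\<integral>x\<in>future -` B. g (case_nat \<sigma> (future x)) \<partial>\<mu>)"
      unfolding set_lebesgue_integral_def
    proof (rule integral_cong_AE)
      show "AE x in \<mu>. indicator (future -` B) x *\<^sub>R real_cond_exp \<mu> ?F (indicator ?E) x
          = indicator (future -` B) x *\<^sub>R g (case_nat \<sigma> (future x))"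
        using cond by eventually_elim simp
    qed measurable
    also have "\<dots> = (\<integral>x. indicator B (future x) * g (case_nat \<sigma> (future x)) \<partial>\<mu>)"
      unfolding set_lebesgue_integral_def
      by (intro Bochner_Integration.integral_cong) (auto split: split_indicator)
    finally have "emeasure \<mu> (?E \<inter> future -` B)
      = ennreal (\<integral>x. indicator B (future x) * g (case_nat \<sigma> (future x)) \<partial>\<mu>)"
      by (simp only: emeasure_eq_measure)
    also have "\<dots> = (\<integral>\<^sup>+x. ennreal (indicator B (future x) * g (case_nat \<sigma> (future x))) \<partial>\<mu>)"
    proof (rule nn_integral_eq_integral[symmetric])
      show "integrable \<mu> (\<lambda>x. indicator B (future x) * g (case_nat \<sigma> (future x)))"
        by (rule integrable_const_bound[where B = 1])
           (auto simp: g_bounds split: split_indicator)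
    qed (simp add: g_bounds)
    also have "\<dots> = (\<integral>\<^sup>+x. ennreal (g (case_nat \<sigma> (future x))) * indicator B (future x) \<partial>\<mu>)"
      by (intro nn_integral_cong) (auto split: split_indicator)
    finally show ?thesis .
  qed
  have "distr (density \<mu> (indicator ?E)) borel future
      = distr (density \<mu> (\<lambda>x. ennreal (g (case_nat \<sigma> (future x))))) borel future"
  proof (rule measure_eqI)
    fix B assume "B \<in> sets (distr (density \<mu> (indicator ?E)) borel future)"
    then have [measurable]: "B \<in> sets borel" by simp
    have [measurable]: "future -` B \<in> sets \<mu>"
      using measurable_sets[OF measurable_future, of B] by (simp add: sets_\<mu>)
    show "emeasure (distr (density \<mu> (indicator ?E)) borel future) B
        = emeasure (distr (density \<mu> (\<lambda>x. ennreal (g (case_nat \<sigma> (future x))))) borel future) B"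
    proof -
      have "emeasure (distr (density \<mu> (indicator ?E)) borel future) B
          = emeasure \<mu> (?E \<inter> future -` B)"
        by (simp add: emeasure_distr sp emeasure_restricted)
      moreover have "emeasure (distr (density \<mu> (\<lambda>x. ennreal (g (case_nat \<sigma> (future x))))) borel future) B
          = (\<integral>\<^sup>+x. ennreal (g (case_nat \<sigma> (future x))) * indicator (future -` B) x \<partial>\<mu>)"
        by (simp add: emeasure_distr sp emeasure_density)
      moreover have "indicator (future -` B) x = (indicator B (future x) :: ennreal)" for x
        by (simp split: split_indicator)
      ultimately show ?thesis by (simp only: E_fut[OF \<open>B \<in> sets borel\<close>])
    qed
  qed simp
  then have "(\<integral>\<^sup>+y. u y \<partial>distr (density \<mu> (indicator ?E)) borel future)
      = (\<integral>\<^sup>+y. u y \<partial>distr (density \<mu> (\<lambda>x. ennreal (g (case_nat \<sigma> (future x))))) borel future)"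
    by simp
  then show ?thesis by (simp add: nn_integral_distr nn_integral_density)
qed

text \<open>
  By shift invariance, \<open>(x\<^sub>1, x\<^sub>2, \<dots>)\<close> has the same law as \<open>(x\<^sub>0,
  x\<^sub>1, \<dots>)\<close>; split the latter according to the value \<open>\<sigma>\<close> of
  \<open>x\<^sub>0\<close> and replace the indicator of that event by its conditional probability.
\<close>

lemma g_measure_stationary:
  fixes g :: "(nat \<Rightarrow> 's::{countable, discrete_topology}) \<Rightarrow> real"
  assumes g: "g_function g" and \<mu>: "g_measure g \<mu>"
  shows "stationary g (distr \<mu> borel future)"
proof -
  have sets_\<mu> [measurable_cong]: "sets \<mu> = sets borel" and prob: "prob_space \<mu>"
    and inv: "distr \<mu> borel shift = \<mu>"
    using \<mu> by (auto simp: g_measure_def)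
  interpret prob_space \<mu> by fact
  have g_meas [measurable]: "g \<in> borel_measurable borel" using g by (simp add: g_function_def)
  have E [measurable]: "{x :: int \<Rightarrow> 's. x 0 = \<sigma>} \<in> sets \<mu>" for \<sigma>
    unfolding sets_\<mu> by (intro borel_open open_coordinate_fixed)
  have "(\<integral>\<^sup>+y. transfer g f y \<partial>distr \<mu> borel future) = (\<integral>\<^sup>+y. f y \<partial>distr \<mu> borel future)"
    if [measurable]: "f \<in> borel_measurable borel" for f :: "(nat \<Rightarrow> 's) \<Rightarrow> ennreal"
  proof -
    let ?r = "\<lambda>(x :: int \<Rightarrow> 's) i. x (int i)"
    have [measurable]: "?r \<in> borel \<rightarrow>\<^sub>M borel"
      by (intro borel_measurable_continuous_onI continuous_on_coordinatewise_then_product) auto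
    have r_shift: "?r (shift x) = future x" for x by (simp add: shift_def future_def)
    have r_cons: "?r x = case_nat (x 0) (future x)" for x
      by (rule ext) (auto simp: future_def add.commute split: nat.split)
    have "(\<integral>\<^sup>+y. f y \<partial>distr \<mu> borel future) = (\<integral>\<^sup>+x. f (future x) \<partial>\<mu>)"
      by (simp add: nn_integral_distr)
    also have "\<dots> = (\<integral>\<^sup>+x. f (?r x) \<partial>distr \<mu> borel shift)"
      by (subst nn_integral_distr) (auto simp: r_shift)
    also have "\<dots> = (\<integral>\<^sup>+x. f (case_nat (x 0) (future x)) \<partial>\<mu>)"
      by (simp add: inv r_cons)
    also have "\<dots> = (\<integral>\<^sup>+x. \<integral>\<^sup>+\<sigma>. indicator {x. x 0 = \<sigma>} x * f (case_nat \<sigma> (future x)) \<partial>count_space UNIV \<partial>\<mu>)"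
    proof (intro nn_integral_cong)
      fix x :: "int \<Rightarrow> 's"
      have "(\<integral>\<^sup>+\<sigma>. indicator {x. x 0 = \<sigma>} x * f (case_nat \<sigma> (future x)) \<partial>count_space UNIV)
          = (\<Sum>\<sigma>\<in>{x 0}. indicator {x. x 0 = \<sigma>} x * f (case_nat \<sigma> (future x)))"
        by (rule nn_integral_count_space') auto
      then show "f (case_nat (x 0) (future x))
          = (\<integral>\<^sup>+\<sigma>. indicator {x. x 0 = \<sigma>} x * f (case_nat \<sigma> (future x)) \<partial>count_space UNIV)"
        by simp
    qed
    also have "\<dots> = (\<integral>\<^sup>+\<sigma>. \<integral>\<^sup>+x. indicator {x. x 0 = \<sigma>} x * f (case_nat \<sigma> (future x)) \<partial>\<mu> \<partial>count_space UNIV)"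
      by (rule nn_integral_count_space_nn_integral) auto
    also have "\<dots> = (\<integral>\<^sup>+\<sigma>. \<integral>\<^sup>+x. ennreal (g (case_nat \<sigma> (future x))) * f (case_nat \<sigma> (future x)) \<partial>\<mu> \<partial>count_space UNIV)"
      by (intro nn_integral_cong g_measure_past_symbol[OF g \<mu>, where u = "\<lambda>y. f (case_nat _ y)"]) auto
    also have "\<dots> = (\<integral>\<^sup>+x. transfer g f (future x) \<partial>\<mu>)"
      unfolding transfer_def by (rule nn_integral_count_space_nn_integral[symmetric]) auto
    also have "\<dots> = (\<integral>\<^sup>+y. transfer g f y \<partial>distr \<mu> borel future)"
      using borel_measurable_transfer[OF g_meas that] by (simp add: nn_integral_distr)
    finally show ?thesis by simp
  qed
  moreover have "prob_space (distr \<mu> borel future)" by (rule prob_space_distr) simp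
  ultimately show ?thesis
    by (simp add: stationary_def prob_space.finite_measure)
qed

theorem corollary4p2:
  fixes g :: "(nat \<Rightarrow> 's::{countable, discrete_topology}) \<Rightarrow> real"
  assumes "g_function g"
    and "\<And>x. g x > 0"
    and "(\<Sum>n. (svar (Suc n) (\<lambda>x. sqrt (g x)))\<^sup>2) < \<infinity>"
  shows "\<exists>\<^sub>\<le>\<^sub>1 \<mu>. g_measure g \<mu>"
proof (rule Uniq_I)
  fix \<mu> \<nu> assume \<mu>: "g_measure g \<mu>" and \<nu>: "g_measure g \<nu>"
  have one_sided: "stationary g (distr \<kappa> borel future)" "prob_space (distr \<kappa> borel future)"
    if "g_measure g \<kappa>" for \<kappa>
  proof -
    show "stationary g (distr \<kappa> borel future)"
      using assms(1) that by (rule g_measure_stationary)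
    have "sets \<kappa> = sets borel" "prob_space \<kappa>" using that by (simp_all add: g_measure_def)
    then show "prob_space (distr \<kappa> borel future)"
      by (intro prob_space.prob_space_distr)
         (simp_all add: measurable_cong_sets[OF \<open>sets \<kappa> = sets borel\<close> refl])
  qed
  have "distr \<mu> borel future = distr \<nu> borel future"
    by (rule stationary_unique[OF assms one_sided[OF \<mu>] one_sided[OF \<nu>]])
  then show "\<mu> = \<nu>"
    by (rule shift_invariant_eq_if_future_eq[rotated 6]) (use \<mu> \<nu> in \<open>simp_all add: g_measure_def\<close>)
qed

end
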